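(* Let $\delta\in\mathbb{N}^*$, let $l>0$ and $\gamma\in(0,1)$ be fixed. For $\varepsilon>0$ let $N^\varepsilon$ be the number of steps of the walk on moving spheres algorithm (A2) (described in the context) with parameters $\delta,l,\gamma,\varepsilon$. Then $N^\varepsilon$ is almost surely finite. Moreover, there exist constants $C_\delta>0$ and $\varepsilon_0(\delta)>0$ such that $$\mathbb{E}[N^\varepsilon]\le C_\delta|\log\varepsilon|\qquad\text{for all }\varepsilon\le\varepsilon_0(\delta).$$
   Context: Put $\nu=\delta/2-1$. Let $\mathcal{S}^\delta$ be the unit sphere of $\mathbb{R}^\delta$ and $\pi_1:\mathbb{R}^\delta\to\mathbb{R}$ the projection on the first coordinate. For $a>0$ let $$\psi_a(t)=\sqrt{2t\log\frac{a}{\Gamma(\nu+1)t^{\nu+1}2^\nu}},\qquad 0\le t\le\left[\frac{a}{\Gamma(\nu+1)2^\nu}\right]^{1/(\nu+1)}.$$ Let $(U_n,G_n,V_n)_{n\ge1}$ be an i.i.d. sequence where, for each $n$, $U_n$ is uniformly distributed on $[0,1]^{\lfloor\nu\rfloor+2}$ (with coordinates $U_n(1),\dots,U_n(\lfloor\nu\rfloor+2)$), $G_n$ is a standard Gaussian random variable, $V_n$ is uniformly distributed on $\mathcal{S}^\delta$, and $U_n,G_n,V_n$ are independent. Algorithm (A2). Start with $\chi(0)=0$, $\xi_0=0$, $\Xi_0=0$, $A_0=\left(\frac{\gamma^2l^2e}{\nu+1}\right)^{\nu+1}\frac{\Gamma(\nu+1)}{2}$. For $n\ge1$, if $\sqrt{\chi(n-1)}<l-\varepsilon$,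 set $$\xi_n=\left(\frac{A_{n-1}}{\Gamma(\nu+1)2^\nu}\,U_n(1)\cdots U_n(\lfloor\nu\rfloor+2)\right)^{1/(\nu+1)}\exp\left\{-\frac{\nu-\lfloor\nu\rfloor}{\nu+1}G_n^2\right\},\qquad \Xi_n=\Xi_{n-1}+\xi_n,$$ $$\chi(n)=\chi(n-1)+2\pi_1(V_n)\sqrt{\chi(n-1)}\,\psi_{A_{n-1}}(\xi_n)+\psi_{A_{n-1}}^2(\xi_n),$$ $$A_n=\left(\frac{\gamma^2(l-\sqrt{\chi(n)})^2e}{\nu+1}\right)^{\nu+1}\frac{\Gamma(\nu+1)}{2}.$$ If $\sqrt{\chi(n-1)}\ge l-\varepsilon$ the algorithm is stopped: $\xi_n=0$, $\Xi_n=\Xi_{n-1}$, $\chi(n)=\chi(n-1)$. The number of steps is $N^\varepsilon=\inf\{n\ge0:\ \sqrt{\chi(n)}\ge l-\varepsilon\}$. *)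

theory Defs
  imports "HOL-Probability.Probability"
begin

text \<open>Vectors in \<open>\<real>\<^sup>d\<close> are functions in \<^term>\<open>space (\<Pi>\<^sub>M i\<in>{1..d}. lborel)\<close>, i.e. extensional functions on
  \<^term>\<open>{1..d::nat}\<close>, so that the dimension may depend on the parameter \<open>\<delta>\<close>; coordinate 1 is the first one.\<close>

abbreviation euclid :: "nat \<Rightarrow> (nat \<Rightarrow> real) measure"
  where "euclid d \<equiv> (\<Pi>\<^sub>M i\<in>{1..d}. lborel)"

definition uniform_cube :: "nat \<Rightarrow> (nat \<Rightarrow> real) measure"
  where "uniform_cube d = uniform_measure (euclid d) ({1..d} \<rightarrow>\<^sub>E {0..1})"

definition unit_sphere :: "nat \<Rightarrow> (nat \<Rightarrow> real) set"
  where "unit_sphere d = {x \<in> space (euclid d). L2_set x {1..d} = 1}"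

definition unit_cball :: "nat \<Rightarrow> (nat \<Rightarrow> real) set"
  where "unit_cball d = {x \<in> space (euclid d). L2_set x {1..d} \<le> 1}"

text \<open>The normalised surface measure of the sphere, as the cone measure
  \<open>A \<mapsto> vol {r v | v \<in> A, 0 \<le> r \<le> 1} / vol (unit ball)\<close>: the law of \<open>X / |X|\<close> for \<open>X\<close> uniform on the ball.
  The null event \<open>X = 0\<close> is sent to 0. For \<open>d = 1\<close> this is the uniform law on \<open>{-1, 1}\<close>.\<close>

definition uniform_sphere :: "nat \<Rightarrow> (nat \<Rightarrow> real) measure"
  where "uniform_sphere d =
    distr (uniform_measure (euclid d) (unit_cball d)) (euclid d)
      (\<lambda>x. \<lambda>i\<in>{1..d}. x i / L2_set x {1..d})"

lemma L2_set_measurable [measurable]: "(\<lambda>x. L2_set x {1..d}) \<in> borel_measurable (euclid d)"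
  unfolding L2_set_def by measurable

lemma unit_cball_sets [measurable]: "unit_cball d \<in> sets (euclid d)"
  unfolding unit_cball_def by measurable

lemma emeasure_unit_cball: "emeasure (euclid d) (unit_cball d) = ennreal (unit_ball_vol (real d))"
proof -
  have "unit_cball d = {f. sqrt (\<Sum>i\<in>{1..d}. (f i)\<^sup>2) \<le> 1} \<inter> space (euclid d)"
    by (auto simp: unit_cball_def L2_set_def)
  then show ?thesis
    using emeasure_cball_aux[of "{1..d}" 1] by simp
qed

lemma prob_space_uniform_cball: "prob_space (uniform_measure (euclid d) (unit_cball d))"
proof (rule prob_space_uniform_measure)
  have "unit_ball_vol (real d) > 0" by simp
  then show "emeasure (euclid d) (unit_cball d) \<noteq> 0" "emeasure (euclid d) (unit_cball d) \<noteq> \<infinity>"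
    unfolding emeasure_unit_cball by (simp_all del: unit_ball_vol_pos)
qed

lemma normalize_measurable [measurable]:
  "(\<lambda>x. \<lambda>i\<in>{1..d}. x i / L2_set x {1..d}) \<in> measurable (euclid d) (euclid d)"
  by (rule measurable_restrict) measurable

lemma prob_space_uniform_sphere: "prob_space (uniform_sphere d)"
proof -
  interpret prob_space "uniform_measure (euclid d) (unit_cball d)"
    by (rule prob_space_uniform_cball)
  show ?thesis
    unfolding uniform_sphere_def by (rule prob_space_distr) measurable
qed

lemma prob_space_uniform_cube: "prob_space (uniform_cube d)"
proof -
  interpret finite_product_sigma_finite "\<lambda>_. lborel :: real measure" "{1..d}"
    by standard simp
  have "emeasure (euclid d) ({1..d} \<rightarrow>\<^sub>E {0..1}) = 1"
    by (subst measure_times) simp_all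
  then show ?thesis
    unfolding uniform_cube_def by (intro prob_space_uniform_measure) simp_all
qed

lemma AE_uniform_sphere:
  assumes "d \<ge> 1"
  shows "AE x in uniform_sphere d. x \<in> unit_sphere d"
proof -
  interpret finite_product_sigma_finite "\<lambda>_. lborel :: real measure" "{1..d}"
    by standard simp
  have L2_normalize: "L2_set (\<lambda>i\<in>{1..d}. x i / L2_set x {1..d}) {1..d} = 1"
    if "L2_set x {1..d} \<noteq> 0" for x :: "nat \<Rightarrow> real"
  proof -
    have "L2_set (\<lambda>i\<in>{1..d}. x i / L2_set x {1..d}) {1..d}
        = L2_set (\<lambda>i. inverse (L2_set x {1..d}) * x i) {1..d}"
      by (rule L2_set_cong) (simp_all add: field_simps)
    also have "\<dots> = inverse (L2_set x {1..d}) * L2_set x {1..d}"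
      by (subst L2_set_right_distrib) simp_all
    finally show ?thesis using that by simp
  qed
  have "emeasure (euclid d) ({1..d} \<rightarrow>\<^sub>E {0}) = 0"
    using assms by (subst measure_times) (simp_all add: power_0_left)
  then have null: "({1..d} \<rightarrow>\<^sub>E {0}) \<in> null_sets (euclid d)"
    by (intro null_setsI sets_PiM_I_finite) (simp_all only: finite_atLeastAtMost, simp)
  have "AE x in euclid d. x \<notin> {1..d} \<rightarrow>\<^sub>E {0}"
    using null by (rule AE_not_in)
  then have "AE x in euclid d. L2_set x {1..d} \<noteq> 0"
  proof (rule AE_mp, intro AE_I2 impI notI)
    fix x assume x: "x \<in> space (euclid d)" "x \<notin> {1..d} \<rightarrow>\<^sub>E {0}" "L2_set x {1..d} = 0"
    then have "\<forall>i\<in>{1..d}. x i = 0" by (simp add: L2_set_eq_0_iff)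
    with x(1) have "x \<in> {1..d} \<rightarrow>\<^sub>E {0}"
      by (simp only: space_PiM PiE_iff) simp
    with x(2) show False by contradiction
  qed
  then have "AE x in uniform_measure (euclid d) (unit_cball d). L2_set x {1..d} \<noteq> 0"
    by (intro AE_uniform_measureI unit_cball_sets) auto
  then have *: "AE x in uniform_measure (euclid d) (unit_cball d).
      (\<lambda>i\<in>{1..d}. x i / L2_set x {1..d}) \<in> unit_sphere d"
    by eventually_elim (use L2_normalize in \<open>auto simp: unit_sphere_def space_PiM\<close>)
  have "{x \<in> space (euclid d). x \<in> unit_sphere d} = unit_sphere d"
    by (auto simp: unit_sphere_def)
  moreover have "unit_sphere d \<in> sets (euclid d)"
    unfolding unit_sphere_def by measurable
  moreover have "(\<lambda>x. \<lambda>i\<in>{1..d}. x i / L2_set x {1..d})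
      \<in> measurable (uniform_measure (euclid d) (unit_cball d)) (euclid d)"
    by measurable
  ultimately show ?thesis
    unfolding uniform_sphere_def using * by (subst AE_distr_iff) (simp_all only:)
qed

definition bessel_index :: "nat \<Rightarrow> real"
  where "bessel_index \<delta> = real \<delta> / 2 - 1"

definition cube_dim :: "nat \<Rightarrow> nat"
  where "cube_dim \<delta> = nat (\<lfloor>bessel_index \<delta>\<rfloor> + 2)"

text \<open>The input sequence \<open>(U\<^sub>n, G\<^sub>n, V\<^sub>n)\<^sub>n\<^sub>\<ge>\<^sub>1\<close>. The library's \<^const>\<open>prob_space.indep_vars\<close> and
  \<^const>\<open>prob_space.indep_var\<close> need a common value type, so the mutual independence of \<open>U\<^sub>n\<close>, \<open>G\<^sub>n\<close>,
  \<open>V\<^sub>n\<close> is stated through the generated \<open>\<sigma>\<close>-algebras, in two steps: \<open>U\<^sub>n\<close> is independent of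
  \<open>(G\<^sub>n, V\<^sub>n)\<close>, and \<open>G\<^sub>n\<close> is independent of \<open>V\<^sub>n\<close>. Together with the three marginal laws this fixes the
  joint law of the triple, so the triples are identically distributed.\<close>

abbreviation generated_sets :: "'a measure \<Rightarrow> ('a \<Rightarrow> 'b) \<Rightarrow> 'b measure \<Rightarrow> 'a set set"
  where "generated_sets M X N \<equiv> sets (vimage_algebra (space M) X N)"

locale wms_input = prob_space M
  for M :: "'a measure" +
  fixes \<delta> :: nat
    and U :: "nat \<Rightarrow> 'a \<Rightarrow> nat \<Rightarrow> real"
    and G :: "nat \<Rightarrow> 'a \<Rightarrow> real"
    and V :: "nat \<Rightarrow> 'a \<Rightarrow> nat \<Rightarrow> real"
  assumes U_uniform: "n \<ge> 1 \<Longrightarrow> distr M (euclid (cube_dim \<delta>)) (U n) = uniform_cube (cube_dim \<delta>)"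
    and G_gaussian: "n \<ge> 1 \<Longrightarrow> distributed M lborel (G n) std_normal_density"
    and V_uniform: "n \<ge> 1 \<Longrightarrow> distr M (euclid \<delta>) (V n) = uniform_sphere \<delta>"
    and U_indep_GV: "n \<ge> 1 \<Longrightarrow>
      indep_set (generated_sets M (U n) (euclid (cube_dim \<delta>)))
        (generated_sets M (\<lambda>\<omega>. (G n \<omega>, V n \<omega>)) (borel \<Otimes>\<^sub>M euclid \<delta>))"
    and G_indep_V: "n \<ge> 1 \<Longrightarrow>
      indep_set (generated_sets M (G n) borel) (generated_sets M (V n) (euclid \<delta>))"
    and indep_seq: "indep_vars (\<lambda>_. euclid (cube_dim \<delta>) \<Otimes>\<^sub>M borel \<Otimes>\<^sub>M euclid \<delta>)
      (\<lambda>n \<omega>. (U n \<omega>, G n \<omega>, V n \<omega>)) {1..}"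

text \<open>The formula for \<open>\<psi>\<^sub>a\<close> is meant for \<open>0 \<le> t \<le> (a / (\<Gamma>(\<nu>+1) 2\<^sup>\<nu>))\<^bsup>1/(\<nu>+1)\<^esup>\<close>, where the radicand is
  nonnegative; the algorithm evaluates it only there.\<close>

definition wms_psi :: "nat \<Rightarrow> real \<Rightarrow> real \<Rightarrow> real"
  where "wms_psi \<delta> a t = (let \<nu> = bessel_index \<delta> in
    sqrt (2 * t * ln (a / (Gamma (\<nu> + 1) * t powr (\<nu> + 1) * 2 powr \<nu>))))"

text \<open>\<open>A\<^sub>n\<close> as a function of \<open>\<chi>(n)\<close>; its value at \<open>\<chi>(0) = 0\<close> is \<open>A\<^sub>0\<close>.\<close>

definition wms_A :: "nat \<Rightarrow> real \<Rightarrow> real \<Rightarrow> real \<Rightarrow> real"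
  where "wms_A \<delta> l \<gamma> x = (let \<nu> = bessel_index \<delta> in
    (\<gamma>\<^sup>2 * (l - sqrt x)\<^sup>2 * exp 1 / (\<nu> + 1)) powr (\<nu> + 1) * (Gamma (\<nu> + 1) / 2))"

definition wms_xi :: "nat \<Rightarrow> real \<Rightarrow> (nat \<Rightarrow> real) \<Rightarrow> real \<Rightarrow> real"
  where "wms_xi \<delta> a u g = (let \<nu> = bessel_index \<delta> in
    (a / (Gamma (\<nu> + 1) * 2 powr \<nu>) * (\<Prod>i=1..cube_dim \<delta>. u i)) powr (1 / (\<nu> + 1))
      * exp (- ((\<nu> - of_int \<lfloor>\<nu>\<rfloor>) / (\<nu> + 1)) * g\<^sup>2))"

text \<open>The state after \<open>n\<close> steps is \<open>(\<chi>(n), \<xi>\<^sub>n, \<Xi>\<^sub>n)\<close>.\<close>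

primrec wms :: "nat \<Rightarrow> real \<Rightarrow> real \<Rightarrow> real \<Rightarrow> (nat \<Rightarrow> nat \<Rightarrow> real) \<Rightarrow> (nat \<Rightarrow> real) \<Rightarrow>
    (nat \<Rightarrow> nat \<Rightarrow> real) \<Rightarrow> nat \<Rightarrow> real \<times> real \<times> real"
  where
    "wms \<delta> l \<gamma> \<epsilon> u g v 0 = (0, 0, 0)"
  | "wms \<delta> l \<gamma> \<epsilon> u g v (Suc n) = (case wms \<delta> l \<gamma> \<epsilon> u g v n of (x, \<xi>, \<Xi>) \<Rightarrow>
      if sqrt x < l - \<epsilon> then
        let a = wms_A \<delta> l \<gamma> x;
            \<xi>' = wms_xi \<delta> a (u (Suc n)) (g (Suc n));
            r = wms_psi \<delta> a \<xi>'
        in (x + 2 * v (Suc n) 1 * sqrt x * r + r\<^sup>2, \<xi>', \<Xi> + \<xi>')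
      else (x, 0, \<Xi>))"

definition wms_chi :: "nat \<Rightarrow> real \<Rightarrow> real \<Rightarrow> real \<Rightarrow> (nat \<Rightarrow> nat \<Rightarrow> real) \<Rightarrow> (nat \<Rightarrow> real) \<Rightarrow>
    (nat \<Rightarrow> nat \<Rightarrow> real) \<Rightarrow> nat \<Rightarrow> real"
  where "wms_chi \<delta> l \<gamma> \<epsilon> u g v n = fst (wms \<delta> l \<gamma> \<epsilon> u g v n)"

text \<open>The infimum is taken in \<^typ>\<open>enat\<close>, so it is \<open>\<infinity>\<close> if the walk never stops.\<close>

definition wms_steps :: "nat \<Rightarrow> real \<Rightarrow> real \<Rightarrow> real \<Rightarrow> (nat \<Rightarrow> 'a \<Rightarrow> nat \<Rightarrow> real) \<Rightarrow>
    (nat \<Rightarrow> 'a \<Rightarrow> real) \<Rightarrow> (nat \<Rightarrow> 'a \<Rightarrow> nat \<Rightarrow> real) \<Rightarrow> 'a \<Rightarrow> enat"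
  where "wms_steps \<delta> l \<gamma> \<epsilon> U G V \<omega> =
    (INF n \<in> {n. sqrt (wms_chi \<delta> l \<gamma> \<epsilon> (\<lambda>k. U k \<omega>) (\<lambda>k. G k \<omega>) (\<lambda>k. V k \<omega>) n) \<ge> l - \<epsilon>}. enat n)"

end

theory Submission
  imports Defs
begin

text \<open>Put \<open>D\<^sub>n = l - \<surd>\<chi>(n)\<close>. Substituting \<open>A\<^sub>n\<close> and \<open>\<xi>\<^sub>n\<close> into \<open>\<psi>\<close> shows that the jump length is
  \<open>\<gamma> D\<^sub>n R\<close>, where \<open>R = \<surd>(e W ln (1/W)) \<in> [0, 1]\<close> depends on the uniform and Gaussian inputs of the
  step only. Projecting the new position on the old direction gives \<open>D\<^sub>n\<^sub>+\<^sub>1 \<le> D\<^sub>n (1 - Y)\<close> with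
  \<open>Y = \<gamma> R \<pi>\<^sub>1(V)\<close>. The variables \<open>Y\<close> of the successive steps are i.i.d., bounded by 1, centred (by
  the symmetry of \<open>V\<close>) and almost surely nonzero, so that \<open>q = 1 - E[Y\<^sup>2] / 16 < 1\<close> bounds
  \<open>E[\<surd>\<bar>1 - Y\<bar>]\<close>. By Markov's inequality \<open>P(N\<^sup>\<epsilon> > n) \<le> \<surd>(l/\<epsilon>) q\<^sup>n\<close>, and summing \<open>min 1 (\<surd>(l/\<epsilon>) q\<^sup>n)\<close>
  over \<open>n\<close> gives the logarithmic bound.\<close>

subsection \<open>The decrease of the distance to the sphere in one step\<close>

text \<open>The random factor of \<open>wms_xi\<close> that does not involve the current position:
  \<open>wms_xi\<close> is \<open>b\<close> times this clock, with b proportional to the squared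
  distance to the sphere. The exponent \<open>2 / real \<delta>\<close> is 1/(\<nu> + 1).\<close>

definition wms_clock :: "nat \<Rightarrow> (nat \<Rightarrow> real) \<Rightarrow> real \<Rightarrow> real"
  where "wms_clock \<delta> u g = (let \<nu> = bessel_index \<delta> in
    (\<Prod>i=1..cube_dim \<delta>. u i) powr (2 / real \<delta>) * exp (- ((\<nu> - of_int \<lfloor>\<nu>\<rfloor>) / (\<nu> + 1)) * g\<^sup>2))"

definition wms_jump :: "nat \<Rightarrow> (nat \<Rightarrow> real) \<Rightarrow> real \<Rightarrow> real"
  where "wms_jump \<delta> u g = sqrt (exp 1 * wms_clock \<delta> u g * ln (1 / wms_clock \<delta> u g))"

text \<open>A function of one whole input triple, so that its moments can be computed under the
  joint law of the triple.\<close>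

definition wms_shift :: "nat \<Rightarrow> real \<Rightarrow> (nat \<Rightarrow> real) \<times> real \<times> (nat \<Rightarrow> real) \<Rightarrow> real"
  where "wms_shift \<delta> \<gamma> = (\<lambda>(u, g, v). \<gamma> * wms_jump \<delta> u g * v 1)"

lemma wms_clock_nonneg: "wms_clock \<delta> u g \<ge> 0"
  by (simp add: wms_clock_def Let_def)

text \<open>The function w ln(1/w) is at most 1/e, by ln t \<le> t - 1 at t = 1/(e w). The factor
  \<open>exp 1\<close> in \<open>wms_A\<close> thus normalises jumps to at most \<gamma> times the
  distance to the sphere.\<close>

lemma wms_jump_le_1: "wms_jump \<delta> u g \<le> 1"
proof (cases "wms_clock \<delta> u g = 0")
  case True
  then show ?thesis by (simp add: wms_jump_def)
next
  case False
  define w where "w = wms_clock \<delta> u g"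
  have w: "w > 0" using False wms_clock_nonneg[of \<delta> u g] by (simp add: w_def)
  have "ln (1 / (exp 1 * w)) \<le> 1 / (exp 1 * w) - 1"
    using w by (intro ln_le_minus_one) simp
  then have "ln (1 / w) \<le> 1 / (exp 1 * w)"
    using w by (simp add: ln_div ln_mult)
  then have "exp 1 * w * ln (1 / w) \<le> exp 1 * w * (1 / (exp 1 * w))"
    using w by (intro mult_left_mono) simp_all
  then have "exp 1 * w * ln (1 / w) \<le> 1" using w by simp
  then show ?thesis unfolding wms_jump_def w_def[symmetric] by simp
qed

text \<open>Scaling: \<open>wms_A\<close> is \<open>b powr (\<nu> + 1)\<close> times the constant in
  the denominator of the logarithm in \<open>wms_psi\<close>. Hence \<open>wms_xi\<close> is
  \<open>b * w\<close>, all powers of b cancel inside the logarithm, and b outside it supplies the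
  square of \<gamma> D.\<close>

lemma wms_psi_eq_jump:
  assumes "\<delta> \<ge> 1" "\<gamma> > 0" "sqrt x < l" and P: "(\<Prod>i=1..cube_dim \<delta>. u i) \<ge> 0"
  shows "wms_psi \<delta> (wms_A \<delta> l \<gamma> x) (wms_xi \<delta> (wms_A \<delta> l \<gamma> x) u g)
    = \<gamma> * (l - sqrt x) * wms_jump \<delta> u g"
proof -
  define p where "p = (\<Prod>i=1..cube_dim \<delta>. u i)"
  define a where "a = wms_A \<delta> l \<gamma> x"
  define w where "w = wms_clock \<delta> u g"
  define \<nu> where "\<nu> = bessel_index \<delta>"
  define D where "D = l - sqrt x"
  define b where "b = \<gamma>\<^sup>2 * D\<^sup>2 * exp 1 / real \<delta>"
  define E where "E = exp (- ((\<nu> - of_int \<lfloor>\<nu>\<rfloor>) / (\<nu> + 1)) * g\<^sup>2)"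
  have D: "D > 0" using assms by (simp add: D_def)
  have \<nu>: "\<nu> + 1 = real \<delta> / 2" by (simp add: \<nu>_def bessel_index_def)
  then have \<nu>_pos: "\<nu> + 1 > 0" using assms by simp
  have b: "b > 0" using D assms by (simp add: b_def)
  have Gam: "Gamma (\<nu> + 1) > 0" using \<nu>_pos by simp
  have "\<gamma>\<^sup>2 * D\<^sup>2 * exp 1 / (\<nu> + 1) = 2 * b" by (simp add: \<nu> b_def)
  then have "a = (2 * b) powr (\<nu> + 1) * (Gamma (\<nu> + 1) / 2)"
    by (simp add: a_def wms_A_def Let_def \<nu>_def D_def)
  also have "\<dots> = b powr (\<nu> + 1) * (Gamma (\<nu> + 1) * 2 powr \<nu>)"
    using b by (simp add: powr_mult powr_add)
  finally have a: "a = b powr (\<nu> + 1) * (Gamma (\<nu> + 1) * 2 powr \<nu>)" .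
  then have a': "a / (Gamma (\<nu> + 1) * 2 powr \<nu>) = b powr (\<nu> + 1)"
    using Gam by simp
  have w: "w = p powr (1 / (\<nu> + 1)) * E"
    by (simp add: w_def wms_clock_def Let_def p_def E_def \<nu>_def[symmetric]) (simp add: \<nu>)
  have "wms_xi \<delta> a u g = (b powr (\<nu> + 1) * p) powr (1 / (\<nu> + 1)) * E"
    unfolding wms_xi_def Let_def \<nu>_def[symmetric] a' p_def E_def ..
  also have "\<dots> = b * w"
    using b P \<nu>_pos by (simp add: w powr_mult powr_powr p_def)
  finally have xi: "wms_xi \<delta> a u g = b * w" .
  have psi: "wms_psi \<delta> a (b * w) = \<gamma> * D * wms_jump \<delta> u g"
  \<comment> \<open>At w = 0 the logarithms only have default values, but they are multiplied by 0
    on both sides.\<close>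
  proof (cases "w = 0")
    case True
    then show ?thesis by (simp add: wms_psi_def wms_jump_def Let_def w_def)
  next
    case False
    then have w_pos: "w > 0" using wms_clock_nonneg[of \<delta> u g] by (simp add: w_def)
    have "a / (Gamma (\<nu> + 1) * (b * w) powr (\<nu> + 1) * 2 powr \<nu>) = (1 / w) powr (\<nu> + 1)"
      using Gam b w_pos by (simp add: a powr_mult powr_divide)
    then have "wms_psi \<delta> a (b * w) = sqrt (2 * (b * w) * ((\<nu> + 1) * ln (1 / w)))"
      using w_pos by (simp add: wms_psi_def Let_def \<nu>_def[symmetric] ln_powr)
    also have "2 * (b * w) * ((\<nu> + 1) * ln (1 / w)) = (\<gamma> * D)\<^sup>2 * (exp 1 * w * ln (1 / w))"
      using assms by (simp add: \<nu> b_def power_mult_distrib)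
    also have "sqrt \<dots> = \<gamma> * D * wms_jump \<delta> u g"
      unfolding wms_jump_def w_def[symmetric] using D assms by (subst real_sqrt_mult) simp
    finally show ?thesis .
  qed
  show ?thesis using xi psi by (simp add: a_def D_def)
qed

text \<open>The new radius is at least the projection \<open>\<surd>\<chi> + \<psi> \<pi>\<^sub>1(V)\<close> of the new position on the old
  direction; as \<open>\<psi>\<close> is proportional to the distance to the sphere, so is the bound on the decrease.\<close>

lemma wms_chi_bounds:
  assumes "\<delta> \<ge> 1" "\<gamma> > 0" "\<epsilon> > 0" "l > 0"
    and P: "\<And>k. k \<ge> 1 \<Longrightarrow> (\<Prod>i=1..cube_dim \<delta>. u k i) \<ge> 0"
    and v: "\<And>k. k \<ge> 1 \<Longrightarrow> \<bar>v k 1\<bar> \<le> 1"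
    and running: "\<And>k. k < n \<Longrightarrow> sqrt (wms_chi \<delta> l \<gamma> \<epsilon> u g v k) < l - \<epsilon>"
  shows "wms_chi \<delta> l \<gamma> \<epsilon> u g v n \<ge> 0 \<and>
    l - sqrt (wms_chi \<delta> l \<gamma> \<epsilon> u g v n) \<le> l * (\<Prod>k=1..n. \<bar>1 - wms_shift \<delta> \<gamma> (u k, g k, v k)\<bar>)"
  using running
proof (induction n)
  case 0
  then show ?case using assms by (simp add: wms_chi_def)
next
  case (Suc n)
  define x where "x = wms_chi \<delta> l \<gamma> \<epsilon> u g v n"
  define s where "s = \<gamma> * (l - sqrt x) * wms_jump \<delta> (u (Suc n)) (g (Suc n))"
  define p where "p = v (Suc n) 1"
  define Y where "Y = wms_shift \<delta> \<gamma> (u (Suc n), g (Suc n), v (Suc n))"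
  let ?Q = "\<Prod>k=1..n. \<bar>1 - wms_shift \<delta> \<gamma> (u k, g k, v k)\<bar>"
  have x: "x \<ge> 0" and IH: "l - sqrt x \<le> l * ?Q"
    using Suc by (simp_all add: x_def)
  have lt: "sqrt x < l - \<epsilon>" using Suc.prems[of n] by (simp add: x_def)
  have "wms_chi \<delta> l \<gamma> \<epsilon> u g v (Suc n) = x + 2 * p * sqrt x * s + s\<^sup>2"
    using lt wms_psi_eq_jump[of \<delta> \<gamma> x l "u (Suc n)" "g (Suc n)"] assms P[of "Suc n"]
    by (cases "wms \<delta> l \<gamma> \<epsilon> u g v n") (simp add: wms_chi_def x_def s_def p_def Let_def)
  \<comment> \<open>The difference of the two sides is \<open>(1 - p^2) * s^2\<close>, the part of
    the squared new radius orthogonal to the old direction.\<close>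
  moreover have "(sqrt x + p * s)\<^sup>2 \<le> x + 2 * p * sqrt x * s + s\<^sup>2"
  proof -
    have "p\<^sup>2 \<le> 1" using v[of "Suc n"] by (simp add: p_def abs_square_le_1)
    then have "p\<^sup>2 * s\<^sup>2 \<le> 1 * s\<^sup>2" by (intro mult_right_mono) simp_all
    then show ?thesis using x by (simp add: power2_sum power_mult_distrib algebra_simps)
  qed
  ultimately have chi: "(sqrt x + p * s)\<^sup>2 \<le> wms_chi \<delta> l \<gamma> \<epsilon> u g v (Suc n)" by simp
  have "sqrt x + p * s \<le> sqrt (wms_chi \<delta> l \<gamma> \<epsilon> u g v (Suc n))"
    using chi by (rule real_le_rsqrt)
  then have "l - sqrt (wms_chi \<delta> l \<gamma> \<epsilon> u g v (Suc n)) \<le> l - sqrt x - p * s"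
    by simp
  also have "\<dots> = (l - sqrt x) * (1 - Y)"
    by (simp add: s_def p_def Y_def wms_shift_def algebra_simps)
  \<comment> \<open>Absolute values make the factor nonnegative, so the induction hypothesis can be
    multiplied by it; the distance itself is positive because the walk is still running.\<close>
  also have "\<dots> \<le> (l - sqrt x) * \<bar>1 - Y\<bar>"
    using lt assms by (intro mult_left_mono) simp_all
  also have "\<dots> \<le> (l * ?Q) * \<bar>1 - Y\<bar>"
    using IH by (rule mult_right_mono) simp
  finally have *: "l - sqrt (wms_chi \<delta> l \<gamma> \<epsilon> u g v (Suc n)) \<le> l * (?Q * \<bar>1 - Y\<bar>)"
    by (simp add: mult.assoc)
  have "0 \<le> (sqrt x + p * s)\<^sup>2" by simp
  with chi have "0 \<le> wms_chi \<delta> l \<gamma> \<epsilon> u g v (Suc n)" by linarith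
  with * show ?case by (simp add: Y_def)
qed

subsection \<open>The uniform laws on the cube and on the sphere\<close>

lemma AE_euclid_component_neq:
  assumes "i \<in> {1..d}"
  shows "AE x in euclid d. x i \<noteq> c"
proof -
  interpret finite_product_sigma_finite "\<lambda>_. lborel :: real measure" "{1..d}"
    by standard simp
  \<comment> \<open>The hyperplane is a box with one degenerate side: a single zero factor
    annihilates the product, although the other sides have infinite length.\<close>
  let ?A = "\<lambda>j. if j = i then {c} else (UNIV :: real set)"
  have "emeasure (euclid d) (Pi\<^sub>E {1..d} ?A) = (\<Prod>j\<in>{1..d}. emeasure lborel (?A j))"
    by (rule measure_times) auto
  also have "\<dots> = 0" using assms by (intro prod_zero) (auto intro!: bexI[of _ i])
  finally have "Pi\<^sub>E {1..d} ?A \<in> null_sets (euclid d)"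
    by (intro null_setsI sets_PiM_I_finite) auto
  then have "AE x in euclid d. x \<notin> Pi\<^sub>E {1..d} ?A" by (rule AE_not_in)
  then show ?thesis
    by (rule AE_mp, intro AE_I2) (auto simp: space_PiM PiE_iff)
qed

lemma sets_uniform_cube [measurable_cong, simp]: "sets (uniform_cube d) = sets (euclid d)"
  by (simp add: uniform_cube_def)

lemma sets_uniform_sphere [measurable_cong, simp]: "sets (uniform_sphere d) = sets (euclid d)"
  by (simp add: uniform_sphere_def)

lemma cube_in_sets: "({1..d} \<rightarrow>\<^sub>E {0..1}) \<in> sets (euclid d)"
  by (intro sets_PiM_I_finite) auto

text \<open>The boundary of the cube lies in finitely many hyperplanes. Strictness at both ends
  later keeps the clock inside (0, 1), where the jump is positive.\<close>

lemma AE_uniform_cube: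
  "AE u in uniform_cube d. \<forall>i\<in>{1..d}. 0 < u i \<and> u i < 1"
proof (rule AE_finite_allI)
  fix i assume i: "i \<in> {1..d}"
  have "AE u in uniform_cube d. u \<in> {1..d} \<rightarrow>\<^sub>E {0..1}"
    unfolding uniform_cube_def by (rule AE_uniform_measureI[OF cube_in_sets]) simp
  moreover have "AE u in uniform_cube d. u i \<noteq> 0"
    unfolding uniform_cube_def
    by (rule AE_uniform_measureI[OF cube_in_sets]) (use AE_euclid_component_neq[OF i, of 0] in auto)
  moreover have "AE u in uniform_cube d. u i \<noteq> 1"
    unfolding uniform_cube_def
    by (rule AE_uniform_measureI[OF cube_in_sets]) (use AE_euclid_component_neq[OF i, of 1] in auto)
  ultimately show "AE u in uniform_cube d. 0 < u i \<and> u i < 1"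
  proof eventually_elim
    case (elim u)
    then have "u i \<in> {0..1}" using i by (auto dest: PiE_mem)
    with elim show ?case by auto
  qed
qed simp

lemma AE_uniform_sphere_abs_le_1:
  assumes "d \<ge> 1"
  shows "AE v in uniform_sphere d. \<bar>v 1\<bar> \<le> 1"
  using AE_uniform_sphere[OF assms]
proof eventually_elim
  case (elim v)
  have "\<bar>v 1\<bar> \<le> L2_set v {1..d}"
    using assms member_le_L2_set[of "{1..d}" 1 "\<lambda>i. \<bar>v i\<bar>"] by (simp add: L2_set_def)
  with elim show ?case by (simp add: unit_sphere_def)
qed

section \<open>Reflection symmetry and the first coordinate of the sphere law\<close>

lemma uminus_measurable_euclid [measurable]:
  "(\<lambda>x. \<lambda>i\<in>{1..d}. - x i) \<in> measurable (euclid d) (euclid d)"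
  by (rule measurable_restrict) measurable

text \<open>It suffices to compare boxes, where the claim factors into the reflection invariance of
  Lebesgue measure on the line.\<close>

lemma distr_euclid_uminus: "distr (euclid d) (euclid d) (\<lambda>x. \<lambda>i\<in>{1..d}. - x i) = euclid d"
proof -
  interpret finite_product_sigma_finite "\<lambda>_. lborel :: real measure" "{1..d}"
    by standard simp
  show ?thesis
  proof (rule PiM_eqI)
    fix A :: "nat \<Rightarrow> real set" assume A: "\<And>i. i \<in> {1..d} \<Longrightarrow> A i \<in> sets lborel"
    have vim: "uminus -` A i \<in> sets lborel" if "i \<in> {1..d}" for i
      using measurable_sets[of uminus borel borel "A i"] A[OF that] by simp
    have "(\<lambda>x. \<lambda>i\<in>{1..d}. - x i) -` Pi\<^sub>E {1..d} A \<inter> space (euclid d)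
        = (\<Pi>\<^sub>E i\<in>{1..d}. uminus -` A i)"
      by (auto simp: space_PiM PiE_iff)
    moreover have "Pi\<^sub>E {1..d} A \<in> sets (euclid d)"
      using A by (intro sets_PiM_I_finite) auto
    ultimately have "emeasure (distr (euclid d) (euclid d) (\<lambda>x. \<lambda>i\<in>{1..d}. - x i)) (Pi\<^sub>E {1..d} A)
        = emeasure (euclid d) (\<Pi>\<^sub>E i\<in>{1..d}. uminus -` A i)"
      by (subst emeasure_distr) simp_all
    also have "\<dots> = (\<Prod>i\<in>{1..d}. emeasure lborel (uminus -` A i))"
      using vim by (rule measure_times)
    also have "\<dots> = (\<Prod>i\<in>{1..d}. emeasure lborel (A i))"
    proof (rule prod.cong)
      fix i assume i: "i \<in> {1..d}"
      have "emeasure lborel (A i) = emeasure (distr lborel borel uminus) (A i)"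
        by (simp add: lborel_distr_uminus)
      also have "\<dots> = emeasure lborel (uminus -` A i)"
        using A[OF i] by (subst emeasure_distr) simp_all
      finally show "emeasure lborel (uminus -` A i) = emeasure lborel (A i)" ..
    qed simp
    finally show "emeasure (distr (euclid d) (euclid d) (\<lambda>x. \<lambda>i\<in>{1..d}. - x i)) (Pi\<^sub>E {1..d} A)
        = (\<Prod>i\<in>{1..d}. emeasure lborel (A i))" .
  qed simp_all
qed

lemma component_1_measurable:
  assumes "d \<ge> 1"
  shows "(\<lambda>x. x 1) \<in> borel_measurable (euclid d)"
  using measurable_component_singleton[of 1 "{1..d}" "\<lambda>_. lborel :: real measure"] assms by simp

text \<open>On the ball the integrand is odd under x \<mapsto> -x, which preserves both Lebesgue
  measure and the ball, so the integral equals its own negative. The function \<open>f\<close>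
  carries the computation to Lebesgue measure, up to the volume of the ball.\<close>

lemma integral_uniform_sphere_component:
  assumes "d \<ge> 1"
  shows "(\<integral>v. v 1 \<partial>uniform_sphere d) = 0"
proof -
  define f where "f x = indicator (unit_cball d) x * (x 1 / L2_set x {1..d})" for x :: "nat \<Rightarrow> real"
  let ?neg = "\<lambda>x :: nat \<Rightarrow> real. \<lambda>i\<in>{1..d}. - x i"
  note component_1_measurable[OF assms, measurable]
  have f_meas: "f \<in> borel_measurable (euclid d)"
    unfolding f_def by measurable
  have L2_neg: "L2_set (?neg x) {1..d} = L2_set x {1..d}" for x
    unfolding L2_set_def by (intro arg_cong[where f = sqrt] sum.cong) simp_all
  have f_neg: "f (?neg x) = - f x" if "x \<in> space (euclid d)" for x
  proof -
    have "?neg x \<in> space (euclid d)" by (simp add: space_PiM)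
    then have "?neg x \<in> unit_cball d \<longleftrightarrow> x \<in> unit_cball d"
      using that unfolding unit_cball_def mem_Collect_eq L2_neg by simp
    then show ?thesis using assms unfolding f_def L2_neg by (simp add: indicator_def)
  qed
  have "(\<integral>x. f x \<partial>euclid d) = (\<integral>x. f x \<partial>distr (euclid d) (euclid d) ?neg)"
    by (simp only: distr_euclid_uminus)
  also have "\<dots> = (\<integral>x. f (?neg x) \<partial>euclid d)"
    by (rule integral_distr[OF uminus_measurable_euclid f_meas])
  also have "\<dots> = (\<integral>x. - f x \<partial>euclid d)"
    by (rule Bochner_Integration.integral_cong[OF refl f_neg])
  finally have f0: "(\<integral>x. f x \<partial>euclid d) = 0" by simp
  have "(\<lambda>x. \<lambda>i\<in>{1..d}. x i / L2_set x {1..d})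
      \<in> measurable (uniform_measure (euclid d) (unit_cball d)) (euclid d)"
    by measurable
  then have "(\<integral>v. v 1 \<partial>uniform_sphere d)
      = (\<integral>x. (\<lambda>i\<in>{1..d}. x i / L2_set x {1..d}) 1 \<partial>uniform_measure (euclid d) (unit_cball d))"
    unfolding uniform_sphere_def by (rule integral_distr[OF _ component_1_measurable[OF assms]])
  also have "\<dots> = (\<integral>x. x 1 / L2_set x {1..d} \<partial>uniform_measure (euclid d) (unit_cball d))"
    using assms by simp
  also have "uniform_measure (euclid d) (unit_cball d)
      = density (euclid d) (\<lambda>x. ennreal (indicator (unit_cball d) x / unit_ball_vol (real d)))"
  proof -
    have "indicator (unit_cball d) x / emeasure (euclid d) (unit_cball d)
        = ennreal (indicator (unit_cball d) x / unit_ball_vol (real d))" for x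
      unfolding emeasure_unit_cball by (subst divide_ennreal[symmetric]) (simp_all add: ennreal_indicator)
    then show ?thesis by (simp add: uniform_measure_def)
  qed
  also have "(\<integral>x. x 1 / L2_set x {1..d} \<partial>\<dots>)
      = (\<integral>x. f x / unit_ball_vol (real d) \<partial>euclid d)"
  proof (subst integral_density)
    show "(\<lambda>x. x 1 / L2_set x {1..d}) \<in> borel_measurable (euclid d)"
      "(\<lambda>x. indicator (unit_cball d) x / unit_ball_vol (real d)) \<in> borel_measurable (euclid d)"
      by measurable
  qed (simp_all add: f_def mult.commute)
  also have "\<dots> = 0"
    using f0 by simp
  finally show ?thesis .
qed

text \<open>Off the null hyperplane \<open>x 1 = 0\<close> the norm is nonzero as well, so
  normalising cannot send the first coordinate to 0.\<close>

lemma AE_uniform_sphere_component_neq_0: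
  assumes "d \<ge> 1"
  shows "AE v in uniform_sphere d. v 1 \<noteq> 0"
proof -
  note component_1_measurable[OF assms, measurable]
  have "AE x in uniform_measure (euclid d) (unit_cball d). x 1 \<noteq> 0"
    by (rule AE_uniform_measureI[OF unit_cball_sets])
      (use AE_euclid_component_neq[of 1 d 0] assms in auto)
  then have "AE x in uniform_measure (euclid d) (unit_cball d).
      (\<lambda>i\<in>{1..d}. x i / L2_set x {1..d}) 1 \<noteq> 0"
  proof eventually_elim
    case (elim x)
    then have "L2_set x {1..d} \<noteq> 0" using assms by (auto simp: L2_set_eq_0_iff)
    then show ?case using elim assms by simp
  qed
  moreover have "(\<lambda>x. \<lambda>i\<in>{1..d}. x i / L2_set x {1..d})
      \<in> measurable (uniform_measure (euclid d) (unit_cball d)) (euclid d)"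
    by measurable
  moreover have "{v \<in> space (euclid d). v 1 \<noteq> 0} \<in> sets (euclid d)"
    by measurable
  ultimately show ?thesis
    unfolding uniform_sphere_def by (subst AE_distr_iff) simp_all
qed

subsection \<open>The law of one step\<close>

text \<open>The product is nested to the right because the input independence is stated in that
  order: first U against the pair (G, V), then G against V.\<close>

definition wms_law :: "nat \<Rightarrow> ((nat \<Rightarrow> real) \<times> real \<times> (nat \<Rightarrow> real)) measure"
  where "wms_law \<delta> = uniform_cube (cube_dim \<delta>) \<Otimes>\<^sub>M
    (std_normal_distribution \<Otimes>\<^sub>M uniform_sphere \<delta>)"

lemma sets_wms_law [measurable_cong, simp]:
  "sets (wms_law \<delta>) = sets (euclid (cube_dim \<delta>) \<Otimes>\<^sub>M borel \<Otimes>\<^sub>M euclid \<delta>)"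
  unfolding wms_law_def by (intro sets_pair_measure_cong) simp_all

lemma prob_space_wms_law: "prob_space (wms_law \<delta>)"
  unfolding wms_law_def
  by (intro prob_space_pair prob_space_uniform_cube prob_space_uniform_sphere
      prob_space_normal_density) simp_all

lemma wms_shift_measurable:
  assumes "\<delta> \<ge> 1"
  shows "wms_shift \<delta> \<gamma> \<in> borel_measurable (euclid (cube_dim \<delta>) \<Otimes>\<^sub>M borel \<Otimes>\<^sub>M euclid \<delta>)"
proof -
  note component_1_measurable[OF assms, measurable]
  show ?thesis
    unfolding wms_shift_def wms_jump_def wms_clock_def Let_def by measurable
qed

text \<open>Since \<nu> \<ge> -1, the integer under \<open>nat\<close> is at least 1. A nonempty
  product of coordinates below 1 is strictly below 1, which \<open>wms_jump_pos\<close> relies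
  on.\<close>

lemma cube_dim_pos: "cube_dim \<delta> \<ge> 1"
proof -
  have "\<lfloor>bessel_index \<delta>\<rfloor> \<ge> -1"
    unfolding bessel_index_def le_floor_iff by simp
  then show ?thesis by (simp add: cube_dim_def)
qed

text \<open>The clock lies strictly between 0 and 1: the power of the product does, and the Gaussian
  factor is positive and at most 1 because the fractional part of \<nu> is nonnegative. So ln(1/w)
  is positive.\<close>

lemma wms_jump_pos:
  assumes "\<delta> \<ge> 1" and u: "\<forall>i\<in>{1..cube_dim \<delta>}. 0 < u i \<and> u i < 1"
  shows "wms_jump \<delta> u g > 0"
proof -
  define \<nu> where "\<nu> = bessel_index \<delta>"
  let ?P = "\<Prod>i=1..cube_dim \<delta>. u i"
  have P: "0 < ?P" using u by (intro prod_pos) simp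
  have "?P < (\<Prod>i=1..cube_dim \<delta>. 1)"
    using u cube_dim_pos[of \<delta>] by (intro prod_mono_strict) (auto simp: less_imp_le)
  then have P1: "?P < 1" by simp
  have "?P powr (2 / real \<delta>) < 1 powr (2 / real \<delta>)"
    using P P1 assms by (intro powr_less_mono2) simp_all
  moreover have "(\<nu> - of_int \<lfloor>\<nu>\<rfloor>) / (\<nu> + 1) \<ge> 0"
    using assms of_int_floor_le[of \<nu>]
    by (intro divide_nonneg_pos) (simp, simp add: \<nu>_def bessel_index_def)
  then have "0 \<le> (\<nu> - of_int \<lfloor>\<nu>\<rfloor>) / (\<nu> + 1) * g\<^sup>2"
    by (rule mult_nonneg_nonneg) simp
  then have "exp (- ((\<nu> - of_int \<lfloor>\<nu>\<rfloor>) / (\<nu> + 1)) * g\<^sup>2) \<le> 1"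
    by simp
  then have "?P powr (2 / real \<delta>) * exp (- ((\<nu> - of_int \<lfloor>\<nu>\<rfloor>) / (\<nu> + 1)) * g\<^sup>2)
      \<le> ?P powr (2 / real \<delta>)"
    by (intro mult_left_le) simp_all
  ultimately have "?P powr (2 / real \<delta>) * exp (- ((\<nu> - of_int \<lfloor>\<nu>\<rfloor>) / (\<nu> + 1)) * g\<^sup>2) < 1"
    by simp
  then have "wms_clock \<delta> u g < 1"
    by (simp add: wms_clock_def Let_def \<nu>_def)
  moreover have "?P powr (2 / real \<delta>) > 0"
    unfolding powr_gt_zero using P by (rule less_imp_neq[THEN not_sym])
  then have "wms_clock \<delta> u g > 0"
    unfolding wms_clock_def Let_def by (rule mult_pos_pos) simp
  ultimately show ?thesis by (simp add: wms_jump_def)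
qed

text \<open>The exceptional sets are covered by null sets A and B, and the strips over A and B are
  null in the product. Passing to covers allows arbitrary predicates P and Q.\<close>

lemma AE_pair_measure_times:
  assumes "sigma_finite_measure M" "sigma_finite_measure N"
    and P: "AE x in M. P x" and Q: "AE y in N. Q y"
  shows "AE z in M \<Otimes>\<^sub>M N. P (fst z) \<and> Q (snd z)"
proof -
  interpret pair_sigma_finite M N
    using assms by (simp add: pair_sigma_finite_def)
  from P obtain A where A: "A \<in> null_sets M" "{x \<in> space M. \<not> P x} \<subseteq> A"
    by (auto simp: eventually_ae_filter)
  from Q obtain B where B: "B \<in> null_sets N" "{x \<in> space N. \<not> Q x} \<subseteq> B"
    by (auto simp: eventually_ae_filter)
  have "A \<times> space N \<in> null_sets (M \<Otimes>\<^sub>M N)" "space M \<times> B \<in> null_sets (M \<Otimes>\<^sub>M N)"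
    using A(1) B(1) by (auto simp: null_sets_def M2.emeasure_pair_measure_Times)
  then have "AE z in M \<Otimes>\<^sub>M N. z \<notin> A \<times> space N" "AE z in M \<Otimes>\<^sub>M N. z \<notin> space M \<times> B"
    by (auto intro: AE_not_in)
  moreover have "AE z in M \<Otimes>\<^sub>M N. z \<in> space (M \<Otimes>\<^sub>M N)" by simp
  ultimately show ?thesis
    by eventually_elim (use A(2) B(2) in \<open>auto simp: space_pair_measure\<close>)
qed

text \<open>The bound gives integrability and access to \<open>sqrt_one_minus_le\<close>;
  nonvanishing makes the second moment positive, hence the contraction strict.\<close>

lemma AE_wms_shift:
  assumes "\<delta> \<ge> 1" "0 < \<gamma>" "\<gamma> < 1"
  shows "AE z in wms_law \<delta>. \<bar>wms_shift \<delta> \<gamma> z\<bar> < 1 \<and> wms_shift \<delta> \<gamma> z \<noteq> 0"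
proof -
  interpret cube: prob_space "uniform_cube (cube_dim \<delta>)" by (rule prob_space_uniform_cube)
  interpret sphere: prob_space "uniform_sphere \<delta>" by (rule prob_space_uniform_sphere)
  interpret normal: prob_space "std_normal_distribution"
    by (rule prob_space_normal_density) simp
  interpret gs: pair_prob_space "std_normal_distribution" "uniform_sphere \<delta>" ..
  have "AE v in uniform_sphere \<delta>. \<bar>v 1\<bar> \<le> 1 \<and> v 1 \<noteq> 0"
    using AE_uniform_sphere_abs_le_1[OF assms(1)] AE_uniform_sphere_component_neq_0[OF assms(1)]
    by eventually_elim simp
  \<comment> \<open>The Gaussian carries the trivial predicate, since \<open>wms_jump_pos\<close>
    holds for every value of g.\<close>
  from AE_pair_measure_times[OF _ _ AE_uniform_cube[of "cube_dim \<delta>"]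
      AE_pair_measure_times[OF _ _ AE_I2[of std_normal_distribution "\<lambda>_. True"] this]]
  have "AE z in wms_law \<delta>. (\<forall>i\<in>{1..cube_dim \<delta>}. 0 < fst z i \<and> fst z i < 1) \<and>
      \<bar>snd (snd z) 1\<bar> \<le> 1 \<and> snd (snd z) 1 \<noteq> 0"
    unfolding wms_law_def
    by (simp add: cube.sigma_finite_measure_axioms sphere.sigma_finite_measure_axioms
        normal.sigma_finite_measure_axioms gs.sigma_finite_measure_axioms)
  then show ?thesis
  proof eventually_elim
    case (elim z)
    obtain u g v where z: "z = (u, g, v)" by (cases z)
    have R: "wms_jump \<delta> u g > 0" using elim assms by (intro wms_jump_pos) (simp_all add: z)
    have "wms_jump \<delta> u g * \<bar>v 1\<bar> \<le> 1 * 1"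
      using R elim wms_jump_le_1[of \<delta> u g] by (intro mult_mono) (simp_all add: z)
    then have "\<gamma> * (wms_jump \<delta> u g * \<bar>v 1\<bar>) \<le> \<gamma> * 1"
      using assms by (intro mult_left_mono) simp_all
    then have "\<gamma> * (wms_jump \<delta> u g * \<bar>v 1\<bar>) < 1"
      using assms(3) unfolding mult_1_right by (rule order_le_less_trans)
    then have "\<bar>wms_shift \<delta> \<gamma> z\<bar> < 1"
      using R assms by (simp add: z wms_shift_def abs_mult mult.assoc)
    moreover have "wms_shift \<delta> \<gamma> z \<noteq> 0"
      using R assms elim by (simp add: z wms_shift_def)
    ultimately show ?case ..
  qed
qed

text \<open>For fixed u and g the shift is a multiple of \<open>v 1\<close>, which is centred under
  the sphere law; Fubini does the rest.\<close>

lemma integral_wms_shift: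
  assumes "\<delta> \<ge> 1" "0 < \<gamma>" "\<gamma> < 1"
  shows "integrable (wms_law \<delta>) (wms_shift \<delta> \<gamma>)" "(\<integral>z. wms_shift \<delta> \<gamma> z \<partial>wms_law \<delta>) = 0"
proof -
  interpret law: prob_space "wms_law \<delta>" by (rule prob_space_wms_law)
  note wms_shift_measurable[OF assms(1), measurable]
  show int: "integrable (wms_law \<delta>) (wms_shift \<delta> \<gamma>)"
    using AE_wms_shift[OF assms] by (intro law.integrable_const_bound[where B = 1]) auto
  interpret cube: prob_space "uniform_cube (cube_dim \<delta>)" by (rule prob_space_uniform_cube)
  interpret sphere: prob_space "uniform_sphere \<delta>" by (rule prob_space_uniform_sphere)
  interpret normal: prob_space "std_normal_distribution"
    by (rule prob_space_normal_density) simp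
  interpret gs: pair_prob_space "std_normal_distribution" "uniform_sphere \<delta>" ..
  interpret ugs: pair_prob_space "uniform_cube (cube_dim \<delta>)"
    "std_normal_distribution \<Otimes>\<^sub>M uniform_sphere \<delta>" ..
  have inner: "(\<integral>y. wms_shift \<delta> \<gamma> (u, y) \<partial>(std_normal_distribution \<Otimes>\<^sub>M uniform_sphere \<delta>)) = 0" for u
  proof (cases "integrable (std_normal_distribution \<Otimes>\<^sub>M uniform_sphere \<delta>) (\<lambda>y. wms_shift \<delta> \<gamma> (u, y))")
    case True
    from gs.integral_fst'[OF this] show ?thesis
      using integral_uniform_sphere_component[OF assms(1)] by (simp add: wms_shift_def)
  next
    \<comment> \<open>A non-integrable section has integral 0 by convention, so the inner integral
      vanishes for every u and not just almost every u.\<close>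
    case False
    then show ?thesis by (rule not_integrable_integral_eq)
  qed
  show "(\<integral>z. wms_shift \<delta> \<gamma> z \<partial>wms_law \<delta>) = 0"
    using ugs.integral_fst'[OF int[unfolded wms_law_def]] by (simp add: wms_law_def inner)
qed

section \<open>Average contraction of the square root of the distance\<close>

text \<open>The linear term has mean zero when y is a shift, so the quadratic term yields the
  contraction. Its Taylor coefficient 1/8 is halved to leave room for the cubic term at negative y:
  squaring leaves the remainder \<open>y^2 * (1/8 + y/16 + y^4/256)\<close> with the last power read
  as \<open>y^2\<close>, nonnegative for y \<ge> -1.\<close>

lemma sqrt_one_minus_le:
  fixes y :: real
  assumes "\<bar>y\<bar> \<le> 1"
  shows "sqrt \<bar>1 - y\<bar> \<le> 1 - y / 2 - y\<^sup>2 / 16"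
proof (rule real_le_lsqrt)
  have y2: "y\<^sup>2 \<le> 1" using assms by (simp add: abs_square_le_1)
  then show "0 \<le> 1 - y / 2 - y\<^sup>2 / 16" using assms by linarith
  have "0 \<le> y\<^sup>2 * (1 / 8 + y / 16 + y\<^sup>2 / 256)"
    using assms zero_le_power2[of y] by (intro mult_nonneg_nonneg) linarith+
  also have "\<dots> = (1 - y / 2 - y\<^sup>2 / 16)\<^sup>2 - (1 - y)"
    by (simp add: power2_eq_square field_simps)
  finally show "\<bar>1 - y\<bar> \<le> (1 - y / 2 - y\<^sup>2 / 16)\<^sup>2" using assms by linarith
qed

text \<open>Depends on \<delta> and \<gamma> alone, which makes the final constant uniform in
  \<epsilon> and in the probability space.\<close>

definition wms_rate :: "nat \<Rightarrow> real \<Rightarrow> real"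
  where "wms_rate \<delta> \<gamma> = 1 - (\<integral>z. (wms_shift \<delta> \<gamma> z)\<^sup>2 \<partial>wms_law \<delta>) / 16"

text \<open>The second moment of the shift is at most 1 and, as the shift is almost surely nonzero,
  positive. Integrating \<open>sqrt_one_minus_le\<close> with a centred shift gives the last
  claim.\<close>

lemma wms_rate_bounds:
  assumes "\<delta> \<ge> 1" "0 < \<gamma>" "\<gamma> < 1"
  shows "0 < wms_rate \<delta> \<gamma>" "wms_rate \<delta> \<gamma> < 1"
    and "(\<integral>\<^sup>+z. ennreal (sqrt \<bar>1 - wms_shift \<delta> \<gamma> z\<bar>) \<partial>wms_law \<delta>) \<le> ennreal (wms_rate \<delta> \<gamma>)"
proof -
  interpret law: prob_space "wms_law \<delta>" by (rule prob_space_wms_law)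
  note wms_shift_measurable[OF assms(1), measurable]
  let ?Y = "wms_shift \<delta> \<gamma>"
  note ae = AE_wms_shift[OF assms]
  have sq: "AE z in wms_law \<delta>. norm ((?Y z)\<^sup>2) \<le> 1"
    using ae by eventually_elim (simp add: abs_square_le_1)
  have int2: "integrable (wms_law \<delta>) (\<lambda>z. (?Y z)\<^sup>2)"
    by (rule law.integrable_const_bound[OF sq]) measurable
  have "(\<integral>z. (?Y z)\<^sup>2 \<partial>wms_law \<delta>) \<le> 1"
    using sq by (intro law.integral_le_const int2) auto
  then show pos: "0 < wms_rate \<delta> \<gamma>" by (simp add: wms_rate_def)
  have "(\<integral>z. (?Y z)\<^sup>2 \<partial>wms_law \<delta>) \<noteq> 0"
  proof
    assume "(\<integral>z. (?Y z)\<^sup>2 \<partial>wms_law \<delta>) = 0"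
    then have "AE z in wms_law \<delta>. (?Y z)\<^sup>2 = 0"
      using integral_nonneg_eq_0_iff_AE[OF int2] by simp
    with ae have "AE z in wms_law \<delta>. False" by eventually_elim simp
    then show False by simp
  qed
  moreover have "(\<integral>z. (?Y z)\<^sup>2 \<partial>wms_law \<delta>) \<ge> 0" by simp
  ultimately show "wms_rate \<delta> \<gamma> < 1" by (simp add: wms_rate_def less_le)
  note int1 = integral_wms_shift(1)[OF assms]
  have "(\<integral>\<^sup>+z. ennreal (sqrt \<bar>1 - ?Y z\<bar>) \<partial>wms_law \<delta>)
      \<le> (\<integral>\<^sup>+z. ennreal (1 - ?Y z / 2 - (?Y z)\<^sup>2 / 16) \<partial>wms_law \<delta>)"
    using ae by (intro nn_integral_mono_AE) (auto intro!: ennreal_leI sqrt_one_minus_le)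
  also have "\<dots> = ennreal (\<integral>z. 1 - ?Y z / 2 - (?Y z)\<^sup>2 / 16 \<partial>wms_law \<delta>)"
  proof (rule nn_integral_eq_integral)
    show "integrable (wms_law \<delta>) (\<lambda>z. 1 - ?Y z / 2 - (?Y z)\<^sup>2 / 16)"
      using int1 int2 by simp
    show "AE z in wms_law \<delta>. 0 \<le> 1 - ?Y z / 2 - (?Y z)\<^sup>2 / 16"
      using ae sq
    proof eventually_elim
      case (elim z)
      then have "?Y z < 1" "(?Y z)\<^sup>2 \<le> 1" by (auto simp: abs_less_iff)
      then show ?case by linarith
    qed
  qed
  also have "(\<integral>z. 1 - ?Y z / 2 - (?Y z)\<^sup>2 / 16 \<partial>wms_law \<delta>) = wms_rate \<delta> \<gamma>"
    using int1 int2 by (simp add: wms_rate_def integral_wms_shift(2)[OF assms] law.prob_space)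
  finally show "(\<integral>\<^sup>+z. ennreal (sqrt \<bar>1 - ?Y z\<bar>) \<partial>wms_law \<delta>) \<le> ennreal (wms_rate \<delta> \<gamma>)" .
qed

subsection \<open>The number of steps\<close>

text \<open>Converts independence of generated \<sigma>-algebras, the form used for the inputs of
  different types, into a product law. Agreement on rectangles is enough.\<close>

lemma (in prob_space) distr_Pair_indep_set:
  assumes X [measurable]: "X \<in> measurable M S" and Y [measurable]: "Y \<in> measurable M T"
    and indep: "indep_set (generated_sets M X S) (generated_sets M Y T)"
  shows "distr M (S \<Otimes>\<^sub>M T) (\<lambda>\<omega>. (X \<omega>, Y \<omega>)) = distr M S X \<Otimes>\<^sub>M distr M T Y"
proof (rule pair_measure_eqI[symmetric])
  show "sigma_finite_measure (distr M S X)" "sigma_finite_measure (distr M T Y)"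
    using X Y by (simp_all add: prob_space_distr prob_space_imp_sigma_finite)
  show "sets (distr M S X \<Otimes>\<^sub>M distr M T Y) = sets (distr M (S \<Otimes>\<^sub>M T) (\<lambda>\<omega>. (X \<omega>, Y \<omega>)))"
    by simp
  fix A B assume "A \<in> sets (distr M S X)" "B \<in> sets (distr M T Y)"
  then have [measurable]: "A \<in> sets S" "B \<in> sets T" by simp_all
  have "emeasure M ((X -` A \<inter> space M) \<inter> (Y -` B \<inter> space M))
      = emeasure M (X -` A \<inter> space M) * emeasure M (Y -` B \<inter> space M)"
    using indep_setD[OF indep, of "X -` A \<inter> space M" "Y -` B \<inter> space M"]
    by (simp add: emeasure_eq_measure ennreal_mult in_vimage_algebra)
  moreover have "(\<lambda>\<omega>. (X \<omega>, Y \<omega>)) -` (A \<times> B) \<inter> space M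
      = (X -` A \<inter> space M) \<inter> (Y -` B \<inter> space M)"
    by auto
  ultimately show "emeasure (distr M S X) A * emeasure (distr M T Y) B
      = emeasure (distr M (S \<Otimes>\<^sub>M T) (\<lambda>\<omega>. (X \<omega>, Y \<omega>))) (A \<times> B)"
    by (simp add: emeasure_distr)
qed

lemma sqrt_prod: "sqrt (\<Prod>i\<in>I. f i) = (\<Prod>i\<in>I. sqrt (f i))"
  by (induction I rule: infinite_finite_induct) (simp_all add: real_sqrt_mult)

context wms_input
begin

abbreviation "input_triple n \<equiv> (\<lambda>\<omega>. (U n \<omega>, G n \<omega>, V n \<omega>))"

lemma input_measurable:
  assumes "n \<ge> 1"
  shows "input_triple n \<in> measurable M (euclid (cube_dim \<delta>) \<Otimes>\<^sub>M borel \<Otimes>\<^sub>M euclid \<delta>)"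
    and "U n \<in> measurable M (euclid (cube_dim \<delta>))"
    and "G n \<in> borel_measurable M"
    and "V n \<in> measurable M (euclid \<delta>)"
proof -
  \<comment> \<open>Measurability of the triple is part of \<open>indep_vars\<close>; the components
    inherit it by projection.\<close>
  show *: "input_triple n \<in> measurable M (euclid (cube_dim \<delta>) \<Otimes>\<^sub>M borel \<Otimes>\<^sub>M euclid \<delta>)"
    using indep_seq assms by (simp add: indep_vars_def)
  show "U n \<in> measurable M (euclid (cube_dim \<delta>))"
    using measurable_compose[OF * measurable_fst] by simp
  show "G n \<in> borel_measurable M"
    using measurable_compose[OF measurable_compose[OF * measurable_snd] measurable_fst] by simp
  show "V n \<in> measurable M (euclid \<delta>)"
    using measurable_compose[OF measurable_compose[OF * measurable_snd] measurable_snd] by simp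
qed

text \<open>The pair lemma is applied twice, first to G and V and then to U and that pair. In
  particular all triples have the same law.\<close>

lemma distr_input:
  assumes n: "n \<ge> 1"
  shows "distr M (euclid (cube_dim \<delta>) \<Otimes>\<^sub>M borel \<Otimes>\<^sub>M euclid \<delta>) (input_triple n) = wms_law \<delta>"
proof -
  note [measurable] = input_measurable(2-4)[OF n]
  have "distr M borel (G n) = distr M lborel (G n)"
    by (rule distr_cong) simp_all
  also have "\<dots> = std_normal_distribution"
    using G_gaussian[OF n] by (simp add: distributed_def)
  finally have G: "distr M borel (G n) = std_normal_distribution" .
  have "distr M (borel \<Otimes>\<^sub>M euclid \<delta>) (\<lambda>\<omega>. (G n \<omega>, V n \<omega>)) = std_normal_distribution \<Otimes>\<^sub>M uniform_sphere \<delta>"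
    using distr_Pair_indep_set[OF input_measurable(3,4)[OF n] G_indep_V[OF n]]
    unfolding G V_uniform[OF n] .
  moreover have "(\<lambda>\<omega>. (G n \<omega>, V n \<omega>)) \<in> measurable M (borel \<Otimes>\<^sub>M euclid \<delta>)"
    by measurable
  ultimately show ?thesis
    using distr_Pair_indep_set[OF input_measurable(2)[OF n] _ U_indep_GV[OF n]]
    by (simp only: U_uniform[OF n] wms_law_def)
qed

section \<open>Tail probabilities of the number of steps\<close>

text \<open>By \<open>wms_chi_bounds\<close>, for admissible inputs this contains the event that the
  walk has not stopped by step n. It is phrased by a product of i.i.d. factors, so its measurability
  and probability do not require the recursion.\<close>

definition far_event :: "real \<Rightarrow> real \<Rightarrow> real \<Rightarrow> nat \<Rightarrow> 'a set"
  where "far_event l \<gamma> \<epsilon> n =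
    {\<omega> \<in> space M. \<epsilon> < l * (\<Prod>k=1..n. \<bar>1 - wms_shift \<delta> \<gamma> (input_triple k \<omega>)\<bar>)}"

lemma shift_measurable:
  assumes "\<delta> \<ge> 1" "k \<ge> 1"
  shows "(\<lambda>\<omega>. wms_shift \<delta> \<gamma> (input_triple k \<omega>)) \<in> borel_measurable M"
  using input_measurable(1)[OF assms(2)] wms_shift_measurable[OF assms(1)]
  by (rule measurable_compose)

lemma far_event_sets:
  assumes "\<delta> \<ge> 1"
  shows "far_event l \<gamma> \<epsilon> n \<in> sets M"
proof -
  have "(\<lambda>\<omega>. \<Prod>k=1..n. \<bar>1 - wms_shift \<delta> \<gamma> (input_triple k \<omega>)\<bar>) \<in> borel_measurable M"
    using shift_measurable[OF assms] by (intro borel_measurable_prod) simp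
  then show ?thesis unfolding far_event_def by simp
qed

text \<open>Markov's inequality for the square root of the bound on the distance; the square root
  makes a centred multiplicative step contract on average.\<close>

lemma emeasure_distance_bound:
  assumes "\<delta> \<ge> 1" "0 < \<gamma>" "\<gamma> < 1" "\<epsilon> > 0" "l > 0"
  shows "emeasure M (far_event l \<gamma> \<epsilon> n)
    \<le> ennreal (sqrt (l / \<epsilon>) * wms_rate \<delta> \<gamma> ^ n)"
proof -
  let ?X = "\<lambda>k \<omega>. sqrt \<bar>1 - wms_shift \<delta> \<gamma> (input_triple k \<omega>)\<bar>"
  let ?S = "far_event l \<gamma> \<epsilon> n"
  note [measurable] = wms_shift_measurable[OF assms(1)]
  have X_meas: "?X k \<in> borel_measurable M" if "k \<in> {1..n}" for k
    using shift_measurable[OF assms(1), of k] that by simp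
  have "(\<lambda>z. sqrt \<bar>1 - wms_shift \<delta> \<gamma> z\<bar>)
      \<in> borel_measurable (euclid (cube_dim \<delta>) \<Otimes>\<^sub>M borel \<Otimes>\<^sub>M euclid \<delta>)"
    by measurable
  then have "indep_vars (\<lambda>_. borel) ?X {1..}"
    by (rule indep_vars_compose2[OF indep_seq])
  then have "indep_vars (\<lambda>_. borel) ?X {1..n}"
    by (rule indep_vars_subset) auto
  then have indep: "indep_vars (\<lambda>_. borel) (\<lambda>k \<omega>. ennreal (?X k \<omega>)) {1..n}"
    by (rule indep_vars_compose2) simp
  have "emeasure M ?S = (\<integral>\<^sup>+\<omega>. indicator ?S \<omega> \<partial>M)"
    using far_event_sets[OF assms(1)] by simp
  also have "\<dots> \<le> (\<integral>\<^sup>+\<omega>. ennreal (sqrt (l / \<epsilon>)) * (\<Prod>k=1..n. ennreal (?X k \<omega>)) \<partial>M)"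
  proof (rule nn_integral_mono)
    fix \<omega>
    show "indicator ?S \<omega> \<le> ennreal (sqrt (l / \<epsilon>)) * (\<Prod>k=1..n. ennreal (?X k \<omega>))"
    proof (cases "\<omega> \<in> ?S")
      case True
      let ?Q = "\<Prod>k=1..n. \<bar>1 - wms_shift \<delta> \<gamma> (input_triple k \<omega>)\<bar>"
      have "1 \<le> l / \<epsilon> * ?Q" using True assms by (simp add: far_event_def field_simps)
      then have "1 \<le> sqrt (l / \<epsilon> * ?Q)" by simp
      also have "\<dots> = sqrt (l / \<epsilon>) * (\<Prod>k=1..n. ?X k \<omega>)"
        by (simp only: real_sqrt_mult sqrt_prod)
      finally have "ennreal 1 \<le> ennreal (sqrt (l / \<epsilon>) * (\<Prod>k=1..n. ?X k \<omega>))"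
        by (rule ennreal_leI)
      then show ?thesis
        using assms True by (simp add: ennreal_mult prod_nonneg prod_ennreal)
    qed simp
  qed
  also have "\<dots> = ennreal (sqrt (l / \<epsilon>)) * (\<integral>\<^sup>+\<omega>. (\<Prod>k=1..n. ennreal (?X k \<omega>)) \<partial>M)"
    using X_meas by (intro nn_integral_cmult borel_measurable_prod) simp
  also have "(\<integral>\<^sup>+\<omega>. (\<Prod>k=1..n. ennreal (?X k \<omega>)) \<partial>M) = (\<Prod>k=1..n. \<integral>\<^sup>+\<omega>. ennreal (?X k \<omega>) \<partial>M)"
    by (rule indep_vars_nn_integral[OF _ indep]) simp_all
  also have "\<dots> = (\<Prod>k=1..n. \<integral>\<^sup>+z. ennreal (sqrt \<bar>1 - wms_shift \<delta> \<gamma> z\<bar>) \<partial>wms_law \<delta>)"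
  proof (rule prod.cong)
    fix k assume "k \<in> {1..n}"
    then have k: "k \<ge> 1" by simp
    show "(\<integral>\<^sup>+\<omega>. ennreal (?X k \<omega>) \<partial>M) = (\<integral>\<^sup>+z. ennreal (sqrt \<bar>1 - wms_shift \<delta> \<gamma> z\<bar>) \<partial>wms_law \<delta>)"
      unfolding distr_input[OF k, symmetric]
      by (rule nn_integral_distr[symmetric, OF input_measurable(1)[OF k]]) measurable
  qed simp
  also have "\<dots> \<le> (\<Prod>k=1..n. ennreal (wms_rate \<delta> \<gamma>))"
    using wms_rate_bounds(3)[OF assms(1-3)] by (simp add: power_mono)
  also have "\<dots> = ennreal (wms_rate \<delta> \<gamma> ^ n)"
    using wms_rate_bounds(1)[OF assms(1-3)] by (simp add: ennreal_power)
  finally show ?thesis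
    using assms wms_rate_bounds(1)[OF assms(1-3)] by (simp add: ennreal_mult mult_left_mono)
qed

text \<open>One null set serves all steps at once, as there are countably many; outside it the
  pathwise bound \<open>wms_chi_bounds\<close> applies.\<close>

lemma AE_admissible:
  assumes "\<delta> \<ge> 1"
  shows "AE \<omega> in M. \<forall>k\<ge>1. (\<Prod>i=1..cube_dim \<delta>. U k \<omega> i) \<ge> 0 \<and> \<bar>V k \<omega> 1\<bar> \<le> 1"
proof -
  have "AE \<omega> in M. k \<ge> 1 \<longrightarrow> (\<Prod>i=1..cube_dim \<delta>. U k \<omega> i) \<ge> 0 \<and> \<bar>V k \<omega> 1\<bar> \<le> 1" for k
  proof (cases "k \<ge> 1")
    case True
    have "AE \<omega> in M. \<forall>i\<in>{1..cube_dim \<delta>}. 0 < U k \<omega> i \<and> U k \<omega> i < 1"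
      using AE_distrD[OF input_measurable(2)[OF True]] AE_uniform_cube[of "cube_dim \<delta>"]
      by (simp only: U_uniform[OF True])
    moreover have "AE \<omega> in M. \<bar>V k \<omega> 1\<bar> \<le> 1"
      using AE_distrD[OF input_measurable(4)[OF True]] AE_uniform_sphere_abs_le_1[OF assms]
      by (simp only: V_uniform[OF True])
    ultimately show ?thesis
      by eventually_elim (auto intro!: prod_nonneg simp: less_imp_le)
  qed simp
  then show ?thesis by (simp add: AE_all_countable)
qed

text \<open>The number of steps is the sum over n of the indicators of n < N, and n < N forces the
  outcome into \<open>far_event\<close> at n.\<close>

lemma wms_steps_le_suminf:
  assumes "\<delta> \<ge> 1" "0 < \<gamma>" "\<epsilon> > 0" "l > 0" "\<omega> \<in> space M"
    and adm: "\<forall>k\<ge>1. (\<Prod>i=1..cube_dim \<delta>. U k \<omega> i) \<ge> 0 \<and> \<bar>V k \<omega> 1\<bar> \<le> 1"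
  shows "ennreal_of_enat (wms_steps \<delta> l \<gamma> \<epsilon> U G V \<omega>) \<le>
    (\<Sum>n. indicator (far_event l \<gamma> \<epsilon> n) \<omega>)"
    (is "?N \<le> (\<Sum>n. indicator (?S n) \<omega>)")
proof -
  let ?chi = "wms_chi \<delta> l \<gamma> \<epsilon> (\<lambda>k. U k \<omega>) (\<lambda>k. G k \<omega>) (\<lambda>k. V k \<omega>)"
  let ?H = "{n. sqrt (?chi n) \<ge> l - \<epsilon>}"
  \<comment> \<open>Indices below n supply the running condition of \<open>wms_chi_bounds\<close>;
    index n itself supplies the strict inequality at time n.\<close>
  have in_S: "\<omega> \<in> ?S n" if "\<And>k. k \<le> n \<Longrightarrow> k \<notin> ?H" for n
  proof -
    have "\<epsilon> < l - sqrt (?chi n)" using that[of n] by simp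
    also have "\<dots> \<le> l * (\<Prod>k=1..n. \<bar>1 - wms_shift \<delta> \<gamma> (input_triple k \<omega>)\<bar>)"
      using wms_chi_bounds[OF assms(1-4), of "\<lambda>k. U k \<omega>" "\<lambda>k. V k \<omega>" n "\<lambda>k. G k \<omega>"] adm that
      by (simp add: not_le)
    finally show ?thesis using assms(5) by (simp add: far_event_def)
  qed
  have le: "of_nat m \<le> (\<Sum>n. indicator (?S n) \<omega> :: ennreal)" if "\<And>k. k < m \<Longrightarrow> k \<notin> ?H" for m
  proof -
    have "of_nat m = (\<Sum>n<m. indicator (?S n) \<omega> :: ennreal)"
    proof -
      have "indicator (?S n) \<omega> = (1 :: ennreal)" if "n < m" for n
        using in_S[of n] \<open>\<And>k. k < m \<Longrightarrow> k \<notin> ?H\<close> that by simp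
      then show ?thesis by simp
    qed
    also have "\<dots> \<le> (\<Sum>n. indicator (?S n) \<omega>)"
      by (rule sum_le_suminf) auto
    finally show ?thesis .
  qed
  show ?thesis
  proof (cases "?H = {}")
    case True
    \<comment> \<open>If the walk never stops, every partial count is a lower bound, so the sum is
      infinite and dominates the value \<infinity> of the infimum.\<close>
    then have "of_nat m \<le> (\<Sum>n. indicator (?S n) \<omega> :: ennreal)" for m by (intro le) auto
    then have "\<not> (\<Sum>n. indicator (?S n) \<omega> :: ennreal) < top"
      using ennreal_Ex_less_of_nat leD by blast
    then have "(\<Sum>n. indicator (?S n) \<omega> :: ennreal) = top"
      by (simp only: not_less top_unique)
    then show ?thesis by simp
  next
    case False
    define m where "m = (LEAST n. n \<in> ?H)"
    have m: "m \<in> ?H" using False by (auto simp: m_def intro: LeastI)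
    have "wms_steps \<delta> l \<gamma> \<epsilon> U G V \<omega> \<le> enat m"
      unfolding wms_steps_def using m by (rule INF_lower)
    then have "?N \<le> ennreal_of_enat (enat m)" by (simp only: ennreal_of_enat_le_iff)
    also have "\<dots> = of_nat m" by simp
    also have "\<dots> \<le> (\<Sum>n. indicator (?S n) \<omega>)"
      by (rule le) (auto simp: m_def dest: not_less_Least)
    finally show ?thesis .
  qed
qed

text \<open>The step count is compared with a measurable sum of indicators by monotonicity almost
  everywhere. The minimum with 1 is kept because the plain geometric sum is of order
  \<open>sqrt (l / \<epsilon>)\<close>, too large for a logarithmic bound.\<close>

lemma nn_integral_wms_steps_le:
  assumes "\<delta> \<ge> 1" "0 < \<gamma>" "\<gamma> < 1" "\<epsilon> > 0" "l > 0"
  shows "AE \<omega> in M. wms_steps \<delta> l \<gamma> \<epsilon> U G V \<omega> < \<infinity>"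
    and "(\<integral>\<^sup>+\<omega>. ennreal_of_enat (wms_steps \<delta> l \<gamma> \<epsilon> U G V \<omega>) \<partial>M)
      \<le> (\<Sum>n. min 1 (ennreal (sqrt (l / \<epsilon>) * wms_rate \<delta> \<gamma> ^ n)))"
proof -
  let ?S = "far_event l \<gamma> \<epsilon>"
  let ?c = "sqrt (l / \<epsilon>)" and ?q = "wms_rate \<delta> \<gamma>"
  note q = wms_rate_bounds(1,2)[OF assms(1-3)]
  note far_event_sets[OF assms(1), measurable]
  have bound: "AE \<omega> in M. ennreal_of_enat (wms_steps \<delta> l \<gamma> \<epsilon> U G V \<omega>) \<le> (\<Sum>n. indicator (?S n) \<omega>)"
    using AE_admissible[OF assms(1)] AE_space
    by eventually_elim (rule wms_steps_le_suminf, use assms in auto)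
  have "(\<integral>\<^sup>+\<omega>. (\<Sum>n. indicator (?S n) \<omega>) \<partial>M) = (\<Sum>n. emeasure M (?S n))"
    by (subst nn_integral_suminf) simp_all
  also have "\<dots> \<le> (\<Sum>n. min 1 (ennreal (?c * ?q ^ n)))"
    using emeasure_distance_bound[OF assms(1-5)] by (intro suminf_le) (auto intro: emeasure_le_1)
  finally have le: "(\<integral>\<^sup>+\<omega>. (\<Sum>n. indicator (?S n) \<omega>) \<partial>M) \<le> (\<Sum>n. min 1 (ennreal (?c * ?q ^ n)))" .
  show "(\<integral>\<^sup>+\<omega>. ennreal_of_enat (wms_steps \<delta> l \<gamma> \<epsilon> U G V \<omega>) \<partial>M)
      \<le> (\<Sum>n. min 1 (ennreal (?c * ?q ^ n)))"
    using nn_integral_mono_AE[OF bound] le by (rule order_trans)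
  have summable: "summable (\<lambda>n. ?c * ?q ^ n)"
    using q by (intro summable_mult summable_geometric) simp
  \<comment> \<open>For almost sure finiteness the plain geometric sum suffices: the sum of
    indicators has finite integral, hence is finite almost everywhere.\<close>
  have "(\<Sum>n. min 1 (ennreal (?c * ?q ^ n))) \<le> (\<Sum>n. ennreal (?c * ?q ^ n))"
    by (intro suminf_le) auto
  also have "\<dots> = ennreal (\<Sum>n. ?c * ?q ^ n)"
    using q assms by (intro suminf_ennreal2 summable) simp
  also have "\<dots> < \<infinity>" by simp
  finally have "(\<integral>\<^sup>+\<omega>. (\<Sum>n. indicator (?S n) \<omega>) \<partial>M) \<noteq> \<infinity>"
    using le by (auto simp: top_unique)
  then have "AE \<omega> in M. (\<Sum>n. indicator (?S n) \<omega> :: ennreal) \<noteq> \<infinity>"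
    by (intro nn_integral_PInf_AE) measurable
  with bound show "AE \<omega> in M. wms_steps \<delta> l \<gamma> \<epsilon> U G V \<omega> < \<infinity>"
  proof eventually_elim
    case (elim \<omega>)
    then show ?case by (cases "wms_steps \<delta> l \<gamma> \<epsilon> U G V \<omega>") (auto simp: top_unique)
  qed
qed

end

section \<open>Summation of the truncated geometric series and the logarithmic bound\<close>

text \<open>From index m on, \<open>c * q ^ m\<close> is at most 1, so the tail is dominated by the
  series of \<open>q ^ n\<close>; each of the first m terms is at most 1. The summand 1 pays for
  rounding m up.\<close>

lemma suminf_min_geometric_le:
  fixes c q :: real
  assumes "c > 0" "0 < q" "q < 1"
  shows "(\<Sum>n. min 1 (ennreal (c * q ^ n))) \<le> ennreal (\<bar>ln c\<bar> / ln (1 / q) + 1 + 1 / (1 - q))"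
proof -
  define m where "m = nat \<lceil>\<bar>ln c\<bar> / ln (1 / q)\<rceil>"
  have lnq: "ln (1 / q) > 0" using assms by simp
  have "\<bar>ln c\<bar> / ln (1 / q) \<ge> 0" using lnq by simp
  then have m_le: "real m \<le> \<bar>ln c\<bar> / ln (1 / q) + 1" and m_ge: "\<bar>ln c\<bar> / ln (1 / q) \<le> real m"
    unfolding m_def by linarith+
  have "ln (c * q ^ m) = ln c - real m * ln (1 / q)"
    using assms by (simp add: ln_mult ln_realpow ln_div)
  also have "\<dots> \<le> 0" using m_ge lnq by (simp add: divide_le_eq)
  finally have cq: "c * q ^ m \<le> 1" using assms by simp
  have "(\<Sum>n. min 1 (ennreal (c * q ^ n)))
      = (\<Sum>n. min 1 (ennreal (c * q ^ (n + m)))) + (\<Sum>n<m. min 1 (ennreal (c * q ^ n)))"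
    by (rule suminf_offset) simp
  also have "\<dots> \<le> (\<Sum>n. ennreal (q ^ n)) + (\<Sum>n<m. 1)"
  proof (intro add_mono suminf_le sum_mono)
    fix n
    have "c * q ^ (n + m) = (c * q ^ m) * q ^ n" by (simp add: power_add)
    also have "\<dots> \<le> 1 * q ^ n" using cq assms by (intro mult_right_mono) simp_all
    finally show "min 1 (ennreal (c * q ^ (n + m))) \<le> ennreal (q ^ n)"
      by (simp add: min.coboundedI2 ennreal_leI)
  qed simp_all
  also have "(\<Sum>n. ennreal (q ^ n)) = ennreal (1 / (1 - q))"
    using assms by (subst suminf_ennreal2) (simp_all add: suminf_geometric summable_geometric)
  also have "(\<Sum>n<m. 1) = ennreal (real m)" by (simp add: ennreal_of_nat_eq_real_of_nat)
  also have "ennreal (1 / (1 - q)) + ennreal (real m) = ennreal (1 / (1 - q) + real m)"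
    using assms by (intro ennreal_plus[symmetric]) simp_all
  also have "\<dots> \<le> ennreal (\<bar>ln c\<bar> / ln (1 / q) + 1 + 1 / (1 - q))"
    using m_le by (intro ennreal_leI) simp
  finally show ?thesis .
qed

theorem theorem2p8:
  fixes \<delta> :: nat and l \<gamma> :: real
  assumes "\<delta> \<ge> 1" and "l > 0" and "0 < \<gamma>" and "\<gamma> < 1"
  shows "(\<forall>\<epsilon>>0. \<forall>(M :: 'a measure) U G V. wms_input M \<delta> U G V \<longrightarrow>
            (AE \<omega> in M. wms_steps \<delta> l \<gamma> \<epsilon> U G V \<omega> < \<infinity>)) \<and>
         (\<exists>C>0. \<exists>\<epsilon>\<^sub>0>0. \<forall>\<epsilon>. 0 < \<epsilon> \<and> \<epsilon> \<le> \<epsilon>\<^sub>0 \<longrightarrow>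
            (\<forall>(M :: 'a measure) U G V. wms_input M \<delta> U G V \<longrightarrow>
              (\<integral>\<^sup>+ \<omega>. ennreal_of_enat (wms_steps \<delta> l \<gamma> \<epsilon> U G V \<omega>) \<partial>M)
                \<le> ennreal (C * \<bar>ln \<epsilon>\<bar>)))"
proof (intro conjI allI impI)
  fix \<epsilon> :: real and M :: "'a measure" and U G V
  assume "\<epsilon> > 0" "wms_input M \<delta> U G V"
  then show "AE \<omega> in M. wms_steps \<delta> l \<gamma> \<epsilon> U G V \<omega> < \<infinity>"
    using assms by (intro wms_input.nn_integral_wms_steps_le(1))
next
  define q where "q = wms_rate \<delta> \<gamma>"
  have q: "0 < q" "q < 1" using wms_rate_bounds(1,2)[of \<delta> \<gamma>] assms by (simp_all add: q_def)
  have lnq: "ln (1 / q) > 0" using q by simp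
  \<comment> \<open>With c = \<open>sqrt (l / \<epsilon>)\<close>, the absolute logarithm of c is at
    most half of \<open>\<bar>ln l\<bar> + \<bar>ln \<epsilon>\<bar>\<close>, whence the 2 in the
    denominator; the other summands are the additive constants of
    \<open>suminf_min_geometric_le\<close>.\<close>
  define C where "C = (\<bar>ln l\<bar> + 1) / (2 * ln (1 / q)) + 1 + 1 / (1 - q)"
  have "0 < \<bar>ln l\<bar> + 1" using abs_ge_zero[of "ln l"] by linarith
  then have "0 < (\<bar>ln l\<bar> + 1) / (2 * ln (1 / q))" using lnq by (intro divide_pos_pos) simp_all
  moreover have "0 < 1 / (1 - q)" using q by simp
  ultimately have "C > 0" unfolding C_def by linarith
  moreover have "(\<integral>\<^sup>+ \<omega>. ennreal_of_enat (wms_steps \<delta> l \<gamma> \<epsilon> U G V \<omega>) \<partial>M) \<le> ennreal (C * \<bar>ln \<epsilon>\<bar>)"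
    if \<epsilon>: "0 < \<epsilon>" "\<epsilon> \<le> exp (-1)" and inp: "wms_input M \<delta> U G V"
    for \<epsilon> and M :: "'a measure" and U G V
  proof -
    \<comment> \<open>The threshold \<open>exp (-1)\<close> is chosen to give
      \<open>\<bar>ln \<epsilon>\<bar> \<ge> 1\<close>, so that every additive constant can be
      absorbed into a multiple of \<open>\<bar>ln \<epsilon>\<bar>\<close>.\<close>
    have "ln \<epsilon> \<le> ln (exp (-1))" using \<epsilon> by (subst ln_le_cancel_iff) simp_all
    then have L: "1 \<le> \<bar>ln \<epsilon>\<bar>" by simp
    have "ln (sqrt (l / \<epsilon>)) = (ln l - ln \<epsilon>) / 2"
      using \<epsilon> assms by (simp add: ln_sqrt ln_div)
    then have "\<bar>ln (sqrt (l / \<epsilon>))\<bar> \<le> (\<bar>ln l\<bar> + \<bar>ln \<epsilon>\<bar>) / 2" by simp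
    also have "\<dots> \<le> (\<bar>ln l\<bar> * \<bar>ln \<epsilon>\<bar> + \<bar>ln \<epsilon>\<bar>) / 2"
      using L mult_left_mono[OF L, of "\<bar>ln l\<bar>"] by simp
    finally have "\<bar>ln (sqrt (l / \<epsilon>))\<bar> / ln (1 / q) \<le> (\<bar>ln l\<bar> * \<bar>ln \<epsilon>\<bar> + \<bar>ln \<epsilon>\<bar>) / 2 / ln (1 / q)"
      using lnq by (intro divide_right_mono) simp_all
    also have "\<dots> = (\<bar>ln l\<bar> + 1) / (2 * ln (1 / q)) * \<bar>ln \<epsilon>\<bar>"
      by (simp add: field_simps)
    finally have 1: "\<bar>ln (sqrt (l / \<epsilon>))\<bar> / ln (1 / q) \<le> (\<bar>ln l\<bar> + 1) / (2 * ln (1 / q)) * \<bar>ln \<epsilon>\<bar>" .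
    have 2: "1 + 1 / (1 - q) \<le> (1 + 1 / (1 - q)) * \<bar>ln \<epsilon>\<bar>"
      using q mult_left_mono[OF L, of "1 + 1 / (1 - q)"] by simp
    have le: "\<bar>ln (sqrt (l / \<epsilon>))\<bar> / ln (1 / q) + 1 + 1 / (1 - q) \<le> C * \<bar>ln \<epsilon>\<bar>"
      using add_mono[OF 1 2] by (simp add: C_def algebra_simps)
    have "(\<integral>\<^sup>+ \<omega>. ennreal_of_enat (wms_steps \<delta> l \<gamma> \<epsilon> U G V \<omega>) \<partial>M)
        \<le> (\<Sum>n. min 1 (ennreal (sqrt (l / \<epsilon>) * q ^ n)))"
      unfolding q_def using inp assms \<epsilon> by (intro wms_input.nn_integral_wms_steps_le(2))
    also have "\<dots> \<le> ennreal (\<bar>ln (sqrt (l / \<epsilon>))\<bar> / ln (1 / q) + 1 + 1 / (1 - q))"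
      using q \<epsilon> assms by (intro suminf_min_geometric_le) simp_all
    also have "\<dots> \<le> ennreal (C * \<bar>ln \<epsilon>\<bar>)"
      using le by (rule ennreal_leI)
    finally show ?thesis .
  qed
  ultimately show "\<exists>C>0. \<exists>\<epsilon>\<^sub>0>0. \<forall>\<epsilon>. 0 < \<epsilon> \<and> \<epsilon> \<le> \<epsilon>\<^sub>0 \<longrightarrow>
            (\<forall>(M :: 'a measure) U G V. wms_input M \<delta> U G V \<longrightarrow>
              (\<integral>\<^sup>+ \<omega>. ennreal_of_enat (wms_steps \<delta> l \<gamma> \<epsilon> U G V \<omega>) \<partial>M)
                \<le> ennreal (C * \<bar>ln \<epsilon>\<bar>))"
    by (intro exI[of _ C] conjI exI[of _ "exp (-1)"]) auto
qed

end
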